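(* Let $R$ be a ring. Then $R$ is strongly $\Delta$-clean if and only if $R$ is strongly clean and $\Delta(R)=\{x\in R \mid 1-x\in U(R)\}$.
   Context: Rings are associative with identity, not necessarily commutative. $U(R)$ is the group of units of $R$. Define $\Delta(R)=\{x\in R \mid 1-xu\in U(R)\text{ for all }u\in U(R)\}$. A ring $R$ is strongly $\Delta$-clean if every $a\in R$ can be written $a=e+d$ with $e^2=e\in R$, $d\in\Delta(R)$ and $ed=de$. A ring $R$ is strongly clean if every $a\in R$ can be written $a=e+u$ with $e^2=e\in R$, $u\in U(R)$ and $eu=ue$. *)

theory Defs
  imports "HOL-Algebra.Ring"
begin

text \<open>The HOL-Algebra locale \<^locale>\<open>ring\<close> is that of associative, unital, not necessarily
  commutative rings; the zero ring is included.\<close>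

definition Delta :: "('a, 'm) ring_scheme \<Rightarrow> 'a set" where
  "Delta R = {x \<in> carrier R. \<forall>u \<in> Units R. \<one>\<^bsub>R\<^esub> \<ominus>\<^bsub>R\<^esub> (x \<otimes>\<^bsub>R\<^esub> u) \<in> Units R}"

definition strongly_Delta_clean :: "('a, 'm) ring_scheme \<Rightarrow> bool" where
  "strongly_Delta_clean R \<longleftrightarrow>
    (\<forall>a \<in> carrier R. \<exists>e \<in> carrier R. \<exists>d \<in> Delta R.
      a = e \<oplus>\<^bsub>R\<^esub> d \<and> e \<otimes>\<^bsub>R\<^esub> e = e \<and> e \<otimes>\<^bsub>R\<^esub> d = d \<otimes>\<^bsub>R\<^esub> e)"

definition strongly_clean :: "('a, 'm) ring_scheme \<Rightarrow> bool" where
  "strongly_clean R \<longleftrightarrow>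
    (\<forall>a \<in> carrier R. \<exists>e \<in> carrier R. \<exists>u \<in> Units R.
      a = e \<oplus>\<^bsub>R\<^esub> u \<and> e \<otimes>\<^bsub>R\<^esub> e = e \<and> e \<otimes>\<^bsub>R\<^esub> u = u \<otimes>\<^bsub>R\<^esub> e)"

end

theory Submission
  imports Defs
begin

text \<open>Every \<open>d \<in> \<Delta>(R)\<close> satisfies \<open>u + d \<in> U(R)\<close> for all units \<open>u\<close>. For an idempotent \<open>e\<close> this
  makes \<open>a = e + d = (1 - e) + ((2e - 1) + d)\<close> a strongly clean decomposition, since
  \<open>(2e - 1)\<^sup>2 = 1\<close>. If \<open>u = e + d\<close> is a unit, then so is the idempotent \<open>e = u - d\<close>, whence \<open>e = 1\<close>
  and \<open>u - 1 \<in> \<Delta>(R)\<close>. Conversely, if \<open>\<Delta>(R) = 1 - U(R)\<close>, then a strongly clean decomposition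
  \<open>a - 1 = e + u\<close> gives \<open>a = e + (1 + u)\<close> with \<open>1 + u = 1 - (-u) \<in> \<Delta>(R)\<close>.\<close>

context ring
begin

lemma Units_a_inv_closed:
  assumes "u \<in> Units R"
  shows "\<ominus> u \<in> Units R"
proof -
  have "u \<in> carrier R" "inv u \<in> carrier R" "inv u \<otimes> u = \<one>" "u \<otimes> inv u = \<one>"
    using assms by auto
  then have "\<ominus> u \<otimes> \<ominus> (inv u) = \<one>" "\<ominus> (inv u) \<otimes> \<ominus> u = \<one>"
    by (simp_all add: l_minus r_minus)
  then show ?thesis
    using \<open>u \<in> carrier R\<close> \<open>inv u \<in> carrier R\<close> unfolding Units_def by blast
qed

text \<open>Cancel the unit \<open>e\<close> on the left of
  \<open>e \<otimes> e = e \<otimes> \<one>\<close>.\<close>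

lemma idempotent_Unit_eq_one:
  assumes "e \<in> Units R" "e \<otimes> e = e"
  shows "e = \<one>"
  using assms Units_l_cancel[of e e \<one>] by (simp add: Units_closed)

lemma Delta_closed: "d \<in> Delta R \<Longrightarrow> d \<in> carrier R"
  by (simp add: Delta_def)

lemma one_minus_Delta_Unit:
  assumes "d \<in> Delta R"
  shows "\<one> \<ominus> d \<in> Units R"
proof -
  have "\<one> \<ominus> (d \<otimes> \<one>) \<in> Units R"
    using assms Units_one_closed unfolding Delta_def by blast
  then show ?thesis
    using assms by (simp add: Delta_closed)
qed

text \<open>The sign moves onto the unit:
  \<open>\<ominus> d \<otimes> u = d \<otimes> \<ominus> u\<close>, and \<open>\<ominus> u\<close>
  is again a unit.\<close>

lemma Delta_a_inv_closed:
  assumes "d \<in> Delta R"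
  shows "\<ominus> d \<in> Delta R"
proof -
  have d: "d \<in> carrier R" using assms by (rule Delta_closed)
  have "\<one> \<ominus> (\<ominus> d \<otimes> u) \<in> Units R" if u: "u \<in> Units R" for u
  proof -
    have "\<one> \<ominus> (d \<otimes> \<ominus> u) \<in> Units R"
      using assms Units_a_inv_closed[OF u] by (simp add: Delta_def)
    moreover have "d \<otimes> \<ominus> u = \<ominus> d \<otimes> u"
      using d u by (simp add: l_minus r_minus Units_closed)
    ultimately show ?thesis by simp
  qed
  then show ?thesis using d by (simp add: Delta_def)
qed

text \<open>Factor out \<open>u\<close> on the right: u + d = (1 - (-d) u^{-1}) u, where the first
  factor is a unit because \<open>\<ominus> d\<close> lies in \<open>Delta R\<close>.\<close>

lemma Units_add_Delta:
  assumes u: "u \<in> Units R" and d: "d \<in> Delta R"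
  shows "u \<oplus> d \<in> Units R"
proof -
  have uc: "u \<in> carrier R" "inv u \<in> carrier R" "inv u \<otimes> u = \<one>" and dc: "d \<in> carrier R"
    using u d by (auto simp: Delta_closed)
  have "\<one> \<ominus> (\<ominus> d \<otimes> inv u) \<in> Units R"
    using Delta_a_inv_closed[OF d] u by (simp add: Delta_def)
  then have "(\<one> \<ominus> (\<ominus> d \<otimes> inv u)) \<otimes> u \<in> Units R"
    using u by (rule Units_m_closed)
  also have "(\<one> \<ominus> (\<ominus> d \<otimes> inv u)) \<otimes> u = u \<oplus> d"
    using uc dc by (simp add: minus_eq l_distr l_minus m_assoc)
  finally show ?thesis .
qed

text \<open>This is 2e - 1, written as a difference of the orthogonal idempotents e and f = 1 - e.
  Its square is e + f = 1, so it is its own inverse.\<close>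

lemma idempotent_reflection_Unit:
  assumes "e \<in> carrier R" "e \<otimes> e = e"
  shows "e \<ominus> (\<one> \<ominus> e) \<in> Units R"
proof -
  define f where "f = \<one> \<ominus> e"
  have f: "f \<in> carrier R" "e \<otimes> f = \<zero>" "f \<otimes> e = \<zero>" "f \<otimes> f = f" "e \<oplus> f = \<one>"
    using assms
    by (simp_all add: f_def minus_eq l_distr r_distr l_minus r_minus r_neg a_lcomm[of e \<one>])
  then have "(e \<ominus> f) \<otimes> (e \<ominus> f) = \<one>" "e \<ominus> f \<in> carrier R"
    using assms by (simp_all add: minus_eq l_distr r_distr l_minus r_minus)
  then show ?thesis
    unfolding f_def[symmetric] Units_def by blast
qed

lemma strongly_Delta_clean_imp_strongly_clean:
  assumes "strongly_Delta_clean R"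
  shows "strongly_clean R"
  unfolding strongly_clean_def
proof
  fix a assume "a \<in> carrier R"
  then obtain e d where e: "e \<in> carrier R" "e \<otimes> e = e" and d: "d \<in> Delta R"
    and a: "a = e \<oplus> d" and comm: "e \<otimes> d = d \<otimes> e"
    using assms unfolding strongly_Delta_clean_def by blast
  have dc: "d \<in> carrier R" using d by (rule Delta_closed)
  define f where "f = \<one> \<ominus> e"
  have f: "f \<in> carrier R" "e \<otimes> f = \<zero>" "f \<otimes> e = \<zero>" "f \<otimes> f = f" "f \<otimes> d = d \<otimes> f"
    using e dc comm
    by (simp_all add: f_def minus_eq l_distr r_distr l_minus r_minus r_neg)
  \<comment> \<open>Chosen so that \<open>f\<close> cancels in f + u = e + d; it is a unit plus an
    element of \<open>Delta R\<close>.\<close>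
  define u where "u = (e \<ominus> f) \<oplus> d"
  have u: "u \<in> Units R"
    unfolding u_def f_def using idempotent_reflection_Unit[OF e] d by (rule Units_add_Delta)
  have "a = f \<oplus> u"
    using e f dc by (simp add: a u_def minus_eq a_ac r_neg)
  moreover have "f \<otimes> u = u \<otimes> f"
    using e f dc by (simp add: u_def minus_eq l_distr r_distr l_minus r_minus)
  ultimately show "\<exists>e\<in>carrier R. \<exists>u\<in>Units R. a = e \<oplus> u \<and> e \<otimes> e = e \<and> e \<otimes> u = u \<otimes> e"
    using f u by blast
qed

lemma strongly_Delta_clean_imp_Delta_eq:
  assumes "strongly_Delta_clean R"
  shows "Delta R = {x \<in> carrier R. \<one> \<ominus> x \<in> Units R}"
proof (intro subset_antisym subsetI)
  fix x assume "x \<in> Delta R"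
  then show "x \<in> {x \<in> carrier R. \<one> \<ominus> x \<in> Units R}"
    by (simp add: Delta_closed one_minus_Delta_Unit)
next
  fix x assume "x \<in> {x \<in> carrier R. \<one> \<ominus> x \<in> Units R}"
  then have x: "x \<in> carrier R" and u: "\<one> \<ominus> x \<in> Units R" by auto
  \<comment> \<open>Decompose the unit 1 - x rather than x: subtracting \<open>d\<close> keeps it a
    unit, which forces its idempotent part to be 1 and leaves d = -x.\<close>
  then obtain e d where e: "e \<in> carrier R" "e \<otimes> e = e" and d: "d \<in> Delta R"
    and eq: "\<one> \<ominus> x = e \<oplus> d"
    using assms unfolding strongly_Delta_clean_def by (meson Units_closed)
  have dc: "d \<in> carrier R" using d by (rule Delta_closed)
  have "(\<one> \<ominus> x) \<oplus> \<ominus> d \<in> Units R"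
    using u Delta_a_inv_closed[OF d] by (rule Units_add_Delta)
  then have "e \<in> Units R"
    using e dc by (simp add: eq a_assoc r_neg)
  then have "e = \<one>"
    using e by (simp add: idempotent_Unit_eq_one)
  then have "d = \<ominus> x"
    using eq x dc by (simp add: minus_eq)
  then show "x \<in> Delta R"
    using Delta_a_inv_closed[OF d] x by simp
qed

lemma strongly_clean_imp_strongly_Delta_clean:
  assumes clean: "strongly_clean R"
    and Delta: "Delta R = {x \<in> carrier R. \<one> \<ominus> x \<in> Units R}"
  shows "strongly_Delta_clean R"
  unfolding strongly_Delta_clean_def
proof
  fix a assume a: "a \<in> carrier R"
  \<comment> \<open>The shift by 1 turns the unit part \<open>u\<close> of a - 1 into 1 + u.\<close>
  then have "a \<ominus> \<one> \<in> carrier R" by simp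
  then obtain e u where e: "e \<in> carrier R" "e \<otimes> e = e" and u: "u \<in> Units R"
    and eq: "a \<ominus> \<one> = e \<oplus> u" and comm: "e \<otimes> u = u \<otimes> e"
    using clean unfolding strongly_clean_def by blast
  have uc: "u \<in> carrier R" using u by (rule Units_closed)
  \<comment> \<open>By the assumed description of \<open>Delta R\<close>, membership of 1 + u only
    requires this difference to be a unit.\<close>
  have "\<one> \<ominus> (\<one> \<oplus> u) = \<ominus> u"
    using uc by (simp add: minus_eq minus_add r_neg2)
  then have "\<one> \<oplus> u \<in> Delta R"
    using uc Units_a_inv_closed[OF u] by (simp add: Delta)
  moreover have "a = e \<oplus> (\<one> \<oplus> u)"
  proof -
    have "a = (a \<ominus> \<one>) \<oplus> \<one>"
      using a by (simp add: minus_eq a_assoc l_neg)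
    then show ?thesis
      using e uc by (simp add: eq a_ac)
  qed
  moreover have "e \<otimes> (\<one> \<oplus> u) = (\<one> \<oplus> u) \<otimes> e"
    using e uc comm by (simp add: l_distr r_distr)
  ultimately show "\<exists>e\<in>carrier R. \<exists>d\<in>Delta R. a = e \<oplus> d \<and> e \<otimes> e = e \<and> e \<otimes> d = d \<otimes> e"
    using e by blast
qed

end

theorem theorem3p1:
  fixes R :: "('a, 'm) ring_scheme" (structure)
  assumes "ring R"
  shows "strongly_Delta_clean R \<longleftrightarrow>
    strongly_clean R \<and> Delta R = {x \<in> carrier R. \<one> \<ominus> x \<in> Units R}"
proof -
  interpret ring R by fact
  show ?thesis
    using strongly_Delta_clean_imp_strongly_clean strongly_Delta_clean_imp_Delta_eq
      strongly_clean_imp_strongly_Delta_clean by blast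
qed

end
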